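(* Let $n\ge 1$ and let $I_n=\{\sigma\in S_n:\sigma^2=\mathrm{id}\}$. The coefficients of the polynomial $$\mathcal{I}_n^{\mathrm{exc}}(x)=\sum_{\sigma\in I_n}x^{\mathrm{exc}(\sigma)}$$ are log-concave.
   Context: $S_n$ is the symmetric group on $\{1,\dots,n\}$, with $\sigma_i=\sigma(i)$. The number of excedances is $\mathrm{exc}(\sigma)=|\{1\le i\le n:\sigma_i>i\}|$. The coefficients $a_0,a_1,\dots,a_m$ of a polynomial are log-concave if $a_j^2\ge a_{j-1}a_{j+1}$ for all $0<j<m$. *)

theory Defs
  imports "HOL-Combinatorics.Permutations" "HOL-Computational_Algebra.Polynomial"
begin

text \<open>The symmetric group on \<open>{1..n}\<close> is rendered as the set of functions
  \<open>\<sigma> :: nat \<Rightarrow> nat\<close> with \<open>\<sigma> permutes {1..n}\<close>; these fix every point outside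
  \<open>{1..n}\<close>, so \<open>\<sigma> \<circ> \<sigma> = id\<close> is the identity of the group. The identity
  permutation itself belongs to this set.\<close>

definition involutions :: "nat \<Rightarrow> (nat \<Rightarrow> nat) set" where
  "involutions n = {\<sigma>. \<sigma> permutes {1..n} \<and> \<sigma> \<circ> \<sigma> = id}"

definition exc :: "nat \<Rightarrow> (nat \<Rightarrow> nat) \<Rightarrow> nat" where
  "exc n \<sigma> = card {i \<in> {1..n}. \<sigma> i > i}"

definition inv_exc_poly :: "nat \<Rightarrow> int poly" where
  "inv_exc_poly n = (\<Sum>\<sigma>\<in>involutions n. monom 1 (exc n \<sigma>))"

text \<open>The coefficient sequence of \<open>p\<close> is \<open>a\<^sub>0, \<dots>, a\<^sub>m\<close> with \<open>m = degree p\<close>.\<close>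

definition log_concave_coeffs :: "'a::linordered_idom poly \<Rightarrow> bool" where
  "log_concave_coeffs p \<longleftrightarrow>
     (\<forall>j. 0 < j \<and> j < degree p \<longrightarrow> (coeff p j)\<^sup>2 \<ge> coeff p (j - 1) * coeff p (j + 1))"

end

theory Submission
  imports Defs
begin

text \<open>
  An involution with \<open>k\<close> excedances is a product of \<open>k\<close> disjoint transpositions, because the smaller
  point of each transposition, and no other point, is an excedance. Let \<open>c\<^sub>k\<close> be the number of these
  involutions. Removing one transposition from an involution with \<open>k + 1\<close> of them is inverse to
  adding a transposition of two fixed points to an involution with \<open>k\<close> of them. Counting both sides
  of this correspondence, with the two points of the transposition in order, gives
  \[ 2 (k + 1) c_{k+1} = (n - 2k) (n - 2k - 1) c_k . \]
  This is \<open>card_involutions_exc_Suc\<close>. The ratio \<open>c\<^sub>k\<^sub>+\<^sub>1 / c\<^sub>k\<close> therefore decreases in \<open>k\<close>, since the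
  factor \<open>(n - 2k) (n - 2k - 1)\<close> decreases and the divisor \<open>2 (k + 1)\<close> increases. For
  positive terms, decreasing ratios of consecutive terms are exactly log-concavity.

  Working with ordered pairs of points keeps the order of \<open>{1..n}\<close> out of the bijection: excedances
  enter only through \<open>card_moved_eq_double_exc\<close>, which counts moved points instead.
\<close>

definition moved :: "(nat \<Rightarrow> nat) \<Rightarrow> nat set" where
  "moved \<sigma> = {i. \<sigma> i \<noteq> i}"

definition involutions_exc :: "nat \<Rightarrow> nat \<Rightarrow> (nat \<Rightarrow> nat) set" where
  "involutions_exc n k = {\<sigma> \<in> involutions n. exc n \<sigma> = k}"

lemma involution_apply_twice: "\<sigma> \<in> involutions n \<Longrightarrow> \<sigma> (\<sigma> x) = x"
  by (auto simp: involutions_def fun_eq_iff)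

lemma involutions_permutes: "\<sigma> \<in> involutions n \<Longrightarrow> \<sigma> permutes {1..n}"
  by (simp add: involutions_def)

lemma moved_subset: "\<sigma> \<in> involutions n \<Longrightarrow> moved \<sigma> \<subseteq> {1..n}"
  using permutes_not_in[OF involutions_permutes] by (fastforce simp: moved_def)

lemma finite_involutions_exc: "finite (involutions_exc n k)"
  by (rule finite_subset[OF _ finite_permutations[of "{1..n}"]])
    (auto simp: involutions_exc_def involutions_def)

text \<open>An involution exchanges its excedances with the points that it moves down.\<close>

lemma card_moved_eq_double_exc:
  assumes "\<sigma> \<in> involutions n"
  shows "card (moved \<sigma>) = 2 * exc n \<sigma>"
proof -
  let ?U = "{i \<in> {1..n}. \<sigma> i > i}" and ?D = "{i \<in> {1..n}. \<sigma> i < i}"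
  note twice = involution_apply_twice[OF assms]
  have "\<sigma> i \<in> {1..n}" if "i \<in> {1..n}" for i
    using permutes_in_image[OF involutions_permutes[OF assms]] that by blast
  then have "\<sigma> ` ?U \<subseteq> ?D" "\<sigma> ` ?D \<subseteq> ?U"
    by (fastforce simp: twice)+
  then have "bij_betw \<sigma> ?U ?D"
    by (intro bij_betw_byWitness[where f' = \<sigma>]) (simp_all add: twice)
  then have "card ?U = card ?D"
    by (rule bij_betw_same_card)
  moreover have "moved \<sigma> = ?U \<union> ?D"
    using moved_subset[OF assms] by (auto simp: moved_def)
  ultimately show ?thesis
    by (simp add: exc_def card_Un_disjoint disjoint_iff)
qed

text \<open>A transposition of two points that \<open>\<sigma>\<close> fixes or exchanges commutes with \<open>\<sigma>\<close>. One lemma thus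
  serves for adding a transposition and for removing one.\<close>

lemma involutions_comp_transpose:
  assumes \<sigma>: "\<sigma> \<in> involutions n" and ij: "i \<in> {1..n}" "j \<in> {1..n}"
    and "\<sigma> i = i \<and> \<sigma> j = j \<or> \<sigma> i = j \<and> \<sigma> j = i"
  shows "\<sigma> \<circ> transpose i j \<in> involutions n"
proof -
  have "(\<sigma> \<circ> transpose i j) ((\<sigma> \<circ> transpose i j) x) = x" for x
  proof (cases "x = i \<or> x = j")
    case True
    then show ?thesis
      using assms(4) by auto
  next
    case False
    then have "\<sigma> x \<noteq> i" "\<sigma> x \<noteq> j"
      using assms(4) involution_apply_twice[OF \<sigma>, of x] by metis+
    then show ?thesis
      using False by (simp add: involution_apply_twice[OF \<sigma>])
  qed
  moreover have "\<sigma> \<circ> transpose i j permutes {1..n}"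
    using permutes_compose[OF permutes_swap_id[OF ij] involutions_permutes[OF \<sigma>]] .
  ultimately show ?thesis
    by (simp add: involutions_def fun_eq_iff)
qed

lemma add_transposition_involutions_exc:
  assumes \<sigma>: "\<sigma> \<in> involutions_exc n k"
    and ij: "i \<in> {1..n} - moved \<sigma>" "j \<in> {1..n} - moved \<sigma>" "i \<noteq> j"
  shows "\<sigma> \<circ> transpose i j \<in> involutions_exc n (Suc k)"
proof -
  have inv: "\<sigma> \<in> involutions n" and exc: "exc n \<sigma> = k"
    using \<sigma> by (auto simp: involutions_exc_def)
  have fixed: "\<sigma> i = i" "\<sigma> j = j"
    using ij by (auto simp: moved_def)
  then have inv': "\<sigma> \<circ> transpose i j \<in> involutions n"
    using involutions_comp_transpose[OF inv] ij by blast
  have "moved (\<sigma> \<circ> transpose i j) = {i, j} \<union> moved \<sigma>"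
    using fixed \<open>i \<noteq> j\<close> by (auto simp: moved_def transpose_def)
  moreover have "finite (moved \<sigma>)"
    using moved_subset[OF inv] finite_subset by blast
  ultimately have "card (moved (\<sigma> \<circ> transpose i j)) = 2 + card (moved \<sigma>)"
    using ij by simp
  then show ?thesis
    using card_moved_eq_double_exc[OF inv] card_moved_eq_double_exc[OF inv'] inv' exc
    by (simp add: involutions_exc_def)
qed

lemma remove_transposition_involutions_exc:
  assumes \<tau>: "\<tau> \<in> involutions_exc n (Suc k)" and i: "i \<in> moved \<tau>"
  shows "\<tau> \<circ> transpose i (\<tau> i) \<in> involutions_exc n k"
    and "moved (\<tau> \<circ> transpose i (\<tau> i)) = moved \<tau> - {i, \<tau> i}"
    and "\<tau> i \<in> moved \<tau>"
proof -
  have inv: "\<tau> \<in> involutions n" and exc: "exc n \<tau> = Suc k"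
    using \<tau> by (auto simp: involutions_exc_def)
  note twice = involution_apply_twice[OF inv]
  show moved_image: "\<tau> i \<in> moved \<tau>"
    using i by (auto simp: moved_def twice)
  then have inv': "\<tau> \<circ> transpose i (\<tau> i) \<in> involutions n"
    using involutions_comp_transpose[OF inv] moved_subset[OF inv] i twice by blast
  show moved_eq: "moved (\<tau> \<circ> transpose i (\<tau> i)) = moved \<tau> - {i, \<tau> i}"
    using i by (auto simp: moved_def transpose_def twice)
  have "card {i, \<tau> i} = 2"
    using i by (simp add: moved_def)
  then have "card (moved (\<tau> \<circ> transpose i (\<tau> i))) = card (moved \<tau>) - 2"
    using i moved_image by (simp add: moved_eq card_Diff_subset)
  then show "\<tau> \<circ> transpose i (\<tau> i) \<in> involutions_exc n k"
    using card_moved_eq_double_exc[OF inv] card_moved_eq_double_exc[OF inv'] inv' exc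
    by (simp add: involutions_exc_def)
qed

text \<open>Choosing a moved point \<open>i\<close> of \<open>\<tau>\<close> chooses the transposition that contains \<open>i\<close>, with \<open>i\<close> as
  its first point. This is why the data on the right is a single point, and each transposition
  counts twice on either side.\<close>

lemma bij_betw_add_transposition:
  "bij_betw (\<lambda>(\<sigma>, i, j). (\<sigma> \<circ> transpose i j, i))
     (SIGMA \<sigma>:involutions_exc n k. SIGMA i:{1..n} - moved \<sigma>. {1..n} - moved \<sigma> - {i})
     (SIGMA \<tau>:involutions_exc n (Suc k). moved \<tau>)"
  (is "bij_betw ?f ?A ?B")
proof (rule bij_betw_byWitness[where f' = "\<lambda>(\<tau>, i). (\<tau> \<circ> transpose i (\<tau> i), i, \<tau> i)"])
  show "\<forall>a\<in>?A. (\<lambda>(\<tau>, i). (\<tau> \<circ> transpose i (\<tau> i), i, \<tau> i)) (?f a) = a"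
    by (auto simp: moved_def comp_assoc)
  show "\<forall>b\<in>?B. ?f ((\<lambda>(\<tau>, i). (\<tau> \<circ> transpose i (\<tau> i), i, \<tau> i)) b) = b"
    by (auto simp: comp_assoc)
  show "?f ` ?A \<subseteq> ?B"
    using add_transposition_involutions_exc by (auto simp: moved_def)
  show "(\<lambda>(\<tau>, i). (\<tau> \<circ> transpose i (\<tau> i), i, \<tau> i)) ` ?B \<subseteq> ?A"
  proof (rule image_subsetI)
    fix b assume "b \<in> ?B"
    then obtain \<tau> i where b: "b = (\<tau>, i)"
      and \<tau>: "\<tau> \<in> involutions_exc n (Suc k)" and i: "i \<in> moved \<tau>"
      by blast
    have "moved \<tau> \<subseteq> {1..n}"
      using moved_subset \<tau> by (auto simp: involutions_exc_def)
    moreover have "\<tau> i \<noteq> i"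
      using i by (simp add: moved_def)
    ultimately show "(\<lambda>(\<tau>, i). (\<tau> \<circ> transpose i (\<tau> i), i, \<tau> i)) b \<in> ?A"
      using remove_transposition_involutions_exc[OF \<tau> i] i
      by (simp add: b subset_iff del: atLeastAtMost_iff)
  qed
qed

text \<open>The truncated subtractions are harmless: if \<open>n < 2 * k\<close> then there are no involutions with \<open>k\<close>
  excedances, and if \<open>n\<close> is \<open>2 * k\<close> or \<open>2 * k + 1\<close> then one of the factors is \<open>0\<close>.\<close>

lemma card_involutions_exc_Suc:
  "2 * Suc k * card (involutions_exc n (Suc k)) =
   (n - 2 * k) * (n - 2 * k - 1) * card (involutions_exc n k)"
proof -
  have inv: "\<sigma> \<in> involutions n" "card (moved \<sigma>) = 2 * m" "finite (moved \<sigma>)"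
    if "\<sigma> \<in> involutions_exc n m" for \<sigma> m
    using that card_moved_eq_double_exc moved_subset finite_subset[of _ "{1..n}"]
    by (auto simp: involutions_exc_def)
  have pairs: "card (SIGMA i:{1..n} - moved \<sigma>. {1..n} - moved \<sigma> - {i}) =
      (n - 2 * k) * (n - 2 * k - 1)" if "\<sigma> \<in> involutions_exc n k" for \<sigma>
    using inv[OF that] moved_subset by (simp add: card_Diff_subset)
  have "card (SIGMA \<sigma>:involutions_exc n k. SIGMA i:{1..n} - moved \<sigma>. {1..n} - moved \<sigma> - {i}) =
      card (SIGMA \<tau>:involutions_exc n (Suc k). moved \<tau>)"
    using bij_betw_add_transposition by (rule bij_betw_same_card)
  then show ?thesis
    using pairs inv by (simp add: finite_involutions_exc mult.commute)
qed

lemma coeff_inv_exc_poly: "coeff (inv_exc_poly n) k = int (card (involutions_exc n k))"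
proof -
  have "finite (involutions n)"
    by (rule finite_subset[OF _ finite_permutations[of "{1..n}"]]) (auto simp: involutions_def)
  then have "(\<Sum>\<sigma>\<in>involutions n. if exc n \<sigma> = k then 1 else 0) =
      int (card (involutions_exc n k))"
    by (simp add: involutions_exc_def sum.If_cases Int_def)
  then show ?thesis
    by (simp add: inv_exc_poly_def coeff_sum)
qed

text \<open>Here \<open>p k / q k\<close> is the ratio \<open>c (Suc k) / c k\<close>; the recurrence form also covers vanishing
  terms, as a sequence with such a recurrence stays \<open>0\<close> from its first zero on.\<close>

lemma log_concave_of_ratio_recurrence:
  fixes c p q :: "nat \<Rightarrow> nat"
  assumes rec: "\<And>k. q k * c (Suc k) = p k * c k"
    and q: "\<And>k. 0 < q k" "mono q" and p: "antimono p"
  shows "c k * c (Suc (Suc k)) \<le> (c (Suc k))\<^sup>2"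
proof (cases "p k = 0")
  case True
  then have "c (Suc k) = 0"
    using rec[of k] q(1)[of k] by simp
  then have "c (Suc (Suc k)) = 0"
    using rec[of "Suc k"] q(1)[of "Suc k"] by simp
  then show ?thesis by simp
next
  case False
  have "p k * q (Suc k) * (c k * c (Suc (Suc k))) = (p k * c k) * (q (Suc k) * c (Suc (Suc k)))"
    by (simp add: mult_ac)
  also have "\<dots> = (p (Suc k) * q k) * (c (Suc k))\<^sup>2"
    using rec[of k] rec[of "Suc k"] by (simp add: power2_eq_square mult_ac)
  also have "\<dots> \<le> p k * q (Suc k) * (c (Suc k))\<^sup>2"
    using monoD[OF q(2), of k "Suc k"] antimonoD[OF p, of k "Suc k"]
    by (intro mult_right_mono mult_mono) auto
  finally show ?thesis
    using False q(1)[of "Suc k"] by simp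
qed

lemma involutions_exc_log_concave:
  "card (involutions_exc n k) * card (involutions_exc n (Suc (Suc k))) \<le>
   (card (involutions_exc n (Suc k)))\<^sup>2"
proof (rule log_concave_of_ratio_recurrence)
  show "2 * Suc k * card (involutions_exc n (Suc k)) =
      (n - 2 * k) * (n - 2 * k - 1) * card (involutions_exc n k)" for k
    by (rule card_involutions_exc_Suc)
  show "mono (\<lambda>k. 2 * Suc k)"
    by (simp add: mono_def)
  show "antimono (\<lambda>k. (n - 2 * k) * (n - 2 * k - 1))"
    by (intro antimonoI mult_le_mono diff_le_mono diff_le_mono2) auto
qed simp

theorem theorem2p1:
  fixes n :: nat
  assumes "n \<ge> 1"
  shows "log_concave_coeffs (inv_exc_poly n)"
  unfolding log_concave_coeffs_def
proof (intro allI impI)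
  fix j assume "0 < j \<and> j < degree (inv_exc_poly n)"
  then obtain k where j: "j = Suc k"
    using gr0_implies_Suc by blast
  have "int (card (involutions_exc n k) * card (involutions_exc n (Suc (Suc k)))) \<le>
      int ((card (involutions_exc n (Suc k)))\<^sup>2)"
    using involutions_exc_log_concave by (simp only: of_nat_le_iff)
  then show "coeff (inv_exc_poly n) (j - 1) * coeff (inv_exc_poly n) (j + 1) \<le>
      (coeff (inv_exc_poly n) j)\<^sup>2"
    by (simp add: j coeff_inv_exc_poly)
qed

end
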